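(* Let $l,r\in\mathbb{N}$ satisfy $l\le r$. Then $$\frac{2\cdot r!\,(l-1)!\,(2r-2l+1)!}{(2r)!\,(r-l)!}\sum_{i=0}^{l-1}\binom{2r}{i}\binom{2r-l-i}{2r-2l+1}=1.$$
   Context: $\mathbb{N}=\{1,2,3,\dots\}$, and $\binom{\cdot}{\cdot}$ denotes the ordinary binomial coefficient. *)

theory Defs imports Complex_Main begin

end

(* With p = l - 1 and e = r - p, the sum is the coefficient of X^p in
   (1 + X)^(2p) * ((1 + X) / (1 - X))^(2e).  Since (1 + X)^2 - 4 X = (1 - X)^2, these coefficients
   g(e, p) satisfy g(e+1, p+1) = 4 g(e+1, p) + g(e, p+1), and the closed form follows by
   induction from g(0, p) = (2p choose p) and g(e, 0) = 1. *)
theory Submission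
  imports Defs "HOL-Computational_Algebra.Formal_Power_Series"
begin

text \<open>Each further factor 1 / (1 - X) replaces the coefficients by their partial sums, and the
  hockey-stick identity evaluates these.\<close>

lemma fps_nth_inverse_one_minus_X_power:
  "fps_nth (inverse (1 - fps_X) ^ Suc m) k = (of_nat ((m + k) choose m) :: 'a :: field)"
proof (induction m arbitrary: k)
  case 0
  show ?case by (simp add: fps_inverse_one_minus_fps_X)
next
  case (Suc m)
  have "fps_nth (inverse (1 - fps_X) ^ Suc (Suc m)) k
      = fps_nth (inverse (1 - fps_X :: 'a fps) ^ Suc m * Abs_fps (\<lambda>_. 1)) k"
    by (simp only: power_Suc2[of _ "Suc m"] fps_inverse_one_minus_fps_X)
  also have "\<dots> = (\<Sum>i\<le>k. of_nat ((m + i) choose m))"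
    by (simp only: fps_mult_nth Suc.IH) (simp add: atLeast0AtMost)
  also have "\<dots> = of_nat (\<Sum>i\<le>k. (m + i) choose i)"
    by (simp add: binomial_symmetric[of m "m + _"])
  also have "(\<Sum>i\<le>k. (m + i) choose i) = Suc (m + k) choose k"
    by (rule sum_choose_lower)
  also have "\<dots> = (Suc m + k) choose Suc m"
    by (simp add: binomial_symmetric[of k])
  finally show ?case .
qed

lemma fps_nth_one_plus_X_power:
  "fps_nth ((1 + fps_X) ^ n) k = (of_nat (n choose k) :: 'a :: field_char_0)"
  by (simp add: binomial_gbinomial flip: fps_binomial_of_nat)

text \<open>The theorem concerns e = r - l + 1; letting e reach 0 gives the induction its base, the
  central binomial coefficients.\<close>

definition central_coeff :: "nat \<Rightarrow> nat \<Rightarrow> real" where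
  "central_coeff e p = fps_nth ((1 + fps_X) ^ (2 * e + 2 * p) * inverse (1 - fps_X) ^ (2 * e)) p"

text \<open>Split one factor (1 + X)^2 into 4 X + (1 - X)^2: the X shifts the coefficient index down
  from p + 1 to p, and (1 - X)^2 cancels two factors of the inverse, lowering e.\<close>

lemma central_coeff_rec:
  "central_coeff (Suc e) (Suc p) = 4 * central_coeff (Suc e) p + central_coeff e (Suc p)"
proof -
  define A B :: "real fps" where "A = 1 + fps_X" and "B = inverse (1 - fps_X)"
  have B: "(1 - fps_X) * B = 1"
    unfolding B_def by (rule inverse_mult_eq_1') simp
  have A: "A\<^sup>2 = 4 * fps_X + (1 - fps_X)\<^sup>2"
    by (simp add: A_def power2_eq_square algebra_simps)
  have "A ^ (2 * Suc e + 2 * Suc p) * B ^ (2 * Suc e)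
      = A\<^sup>2 * (A ^ (2 * Suc e + 2 * p) * B ^ (2 * Suc e))"
    by (simp add: power2_eq_square)
  \<comment> \<open>The same power of \<open>A\<close> serves both terms, since 2(e+1) + 2p = 2e +
    2(p+1).\<close>
  also have "\<dots> = 4 * (fps_X * (A ^ (2 * Suc e + 2 * p) * B ^ (2 * Suc e)))
      + ((1 - fps_X) * B)\<^sup>2 * (A ^ (2 * e + 2 * Suc p) * B ^ (2 * e))"
    unfolding A by (simp add: power2_eq_square algebra_simps)
  finally have "A ^ (2 * Suc e + 2 * Suc p) * B ^ (2 * Suc e)
      = fps_const 4 * (fps_X * (A ^ (2 * Suc e + 2 * p) * B ^ (2 * Suc e)))
        + A ^ (2 * e + 2 * Suc p) * B ^ (2 * e)"
    by (simp only: B power_one mult_1 fps_numeral_fps_const)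
  then show ?thesis
    unfolding central_coeff_def A_def B_def
    by (simp only: fps_add_nth fps_mult_left_const_nth fps_X_mult_nth) simp
qed

lemma central_coeff_closed:
  "central_coeff e p = fact (2 * e + 2 * p) * fact e / (fact (e + p) * fact p * fact (2 * e))"
proof (induction e arbitrary: p)
  case 0
  show ?case
    by (simp add: central_coeff_def fps_nth_one_plus_X_power binomial_fact)
next
  case (Suc e)
  \<comment> \<open>The recursion lowers either e or p, so an induction on p is nested inside; the
    outer hypothesis, valid for every p, is saved before \<open>Suc\<close> is rebound.\<close>
  note IH = Suc.IH
  show ?case
  proof (induction p)
    case 0
    show ?case by (simp add: central_coeff_def fps_nth_power_0)
  next
    case (Suc p)
    \<comment> \<open>Both terms of the recursion share these factorials. After division by a e! /
      (c (p+1)! (2e)!), the claim is (2e+2p+3)/(2e+1) = 2(p+1)/(2e+1) + 1.\<close>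
    define a c where "a = (fact (2 * e + 2 * p + 2) :: real)" and "c = (fact (e + p + 1) :: real)"
    have a: "fact (2 * Suc e + 2 * Suc p) = (2 * e + 2 * p + 4) * (2 * e + 2 * p + 3) * a"
      "fact (2 * Suc e + 2 * p) = a" "fact (2 * e + 2 * Suc p) = a"
      by (simp_all add: a_def algebra_simps)
    have c: "fact (Suc e + Suc p) = (e + p + 2) * c"
      "fact (Suc e + p) = c" "fact (e + Suc p) = c"
      by (simp_all add: c_def algebra_simps)
    have f: "fact (Suc e) = (e + 1) * (fact e :: real)" "fact (Suc p) = (p + 1) * (fact p :: real)"
      "fact (2 * Suc e) = (2 * e + 2) * (2 * e + 1) * (fact (2 * e) :: real)"
      by (simp_all add: algebra_simps)
    have "c > 0" by (simp add: c_def)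
    then have nz: "c \<noteq> 0" "real e + 1 \<noteq> 0" "real p + 1 \<noteq> 0" "2 * real e + 1 \<noteq> 0"
      "2 * real e + 2 \<noteq> 0" "real e + real p + 2 \<noteq> 0"
      by linarith+
    show ?case
      unfolding central_coeff_rec Suc IH a c f using nz
      by (simp add: divide_simps) (simp add: algebra_simps add_nonneg_eq_0_iff)
  qed
qed

theorem lemma2p7:
  fixes l r :: nat
  assumes "1 \<le> l" and "l \<le> r"
  shows "(2 * fact r * fact (l - 1) * fact (2 * r - 2 * l + 1)) / (fact (2 * r) * fact (r - l))
           * (\<Sum>i = 0..l - 1. real ((2 * r) choose i) * real ((2 * r - l - i) choose (2 * r - 2 * l + 1)))
         = (1 :: real)"
proof -
  obtain p where l: "l = Suc p" using assms(1) by (cases l) auto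
  obtain d where r: "r = Suc d + p" using assms(2) l by (metis add.commute add_Suc_shift le_Suc_ex)
  have idx: "l - 1 = p" "2 * r - 2 * l + 1 = Suc (2 * d)" "r - l = d" "2 * r = 2 * Suc d + 2 * p"
    by (simp_all add: l r)
  have "(\<Sum>i = 0..l - 1. real ((2 * r) choose i) * real ((2 * r - l - i) choose (2 * r - 2 * l + 1)))
      = (\<Sum>i = 0..p. fps_nth ((1 + fps_X) ^ (2 * r)) i
          * fps_nth (inverse (1 - fps_X) ^ Suc (Suc (2 * d))) (p - i))"
  proof (rule sum.cong)
    fix i assume "i \<in> {0..p}"
    \<comment> \<open>As i \<le> p, nothing is truncated, and the second binomial is the coefficient
      of X^(p-i) in (1 - X)^(-(2d+2)); the sum is thus a Cauchy product.\<close>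
    then have "2 * r - l - i = Suc (2 * d) + (p - i)" by (simp add: l r)
    then show "real ((2 * r) choose i) * real ((2 * r - l - i) choose (2 * r - 2 * l + 1))
      = fps_nth ((1 + fps_X) ^ (2 * r)) i
          * fps_nth (inverse (1 - fps_X) ^ Suc (Suc (2 * d))) (p - i)"
      by (simp only: fps_nth_inverse_one_minus_X_power fps_nth_one_plus_X_power idx(2))
  qed (simp add: l)
  also have "\<dots> = central_coeff (Suc d) p"
    by (simp add: central_coeff_def fps_mult_nth idx(4))
  also have "\<dots> = fact (2 * r) * fact (Suc d) / (fact r * fact p * fact (2 * Suc d))"
    unfolding central_coeff_closed by (simp add: r)
  \<comment> \<open>Here the factor 2 of the theorem arises; the d + 1 cancels against the one in
    (d+1)!, leaving the reciprocal of the prefactor.\<close>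
  also have "fact (2 * Suc d) = 2 * real (Suc d) * fact (Suc (2 * d))"
    by (simp add: algebra_simps)
  also have "fact (Suc d) = real (Suc d) * fact d"
    by simp
  finally show ?thesis
    unfolding idx(1-3) by (simp add: field_simps del: of_nat_Suc fact_Suc)
qed

end
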